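(* For each prime $p>3$ there exists a local nearring $R$ whose additive group $R^+$ is isomorphic to the group $H_1$ of order $p^4$.
   Context: A (left) nearring is a non-empty set $R$ with two binary operations $+$ and $\cdot$ such that $(R,+)$ is a (not necessarily abelian) group with neutral element $0$, $(R,\cdot)$ is a semigroup, and $x\cdot(y+z)=x\cdot y+x\cdot z$ for all $x,y,z\in R$. The group $(R,+)$ is denoted $R^+$ and called the additive group of $R$. $R$ is a nearring with identity if $(R,\cdot)$ is a monoid. A nearring with identity is called local if the set $L$ of all non-invertible elements of the monoid $(R,\cdot)$ is a subgroup of $R^+$. For a prime $p>3$, $H_1$ is the group of order $p^4$ and nilpotency class $3$ with (multiplicative) presentation $$H_1=\langle a,b \colon a^p=b^p=c^p=[a,c]^p=[b,c]=e,\ [a,[a,c]]=[b,[a,c]]=e\rangle,\qquad c=[a,b],$$ where $[x,y]=x^{-1}y^{-1}xy$; it has the structure $(C_p\times C_p\times C_p)\rtimes C_p$. *)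

theory Defs
  imports "HOL-Algebra.Ring" "HOL-Algebra.Coset" "HOL-Computational_Algebra.Primes"
begin

section \<open>Local nearrings\<close>

text \<open>
  The record type of rings is reused. The locale \<open>nearring\<close> says nothing about the field
  \<open>one\<close>, so its multiplicative part is just a semigroup, and it does not assume
  \<open>\<zero> \<otimes> x = \<zero>\<close>.
\<close>

locale nearring =
  fixes R (structure)
  assumes add_group: "group (add_monoid R)"
    and mult_closed: "\<lbrakk>x \<in> carrier R; y \<in> carrier R\<rbrakk> \<Longrightarrow> x \<otimes> y \<in> carrier R"
    and mult_assoc: "\<lbrakk>x \<in> carrier R; y \<in> carrier R; z \<in> carrier R\<rbrakk>
      \<Longrightarrow> (x \<otimes> y) \<otimes> z = x \<otimes> (y \<otimes> z)"
    and left_distrib: "\<lbrakk>x \<in> carrier R; y \<in> carrier R; z \<in> carrier R\<rbrakk>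
      \<Longrightarrow> x \<otimes> (y \<oplus> z) = x \<otimes> y \<oplus> x \<otimes> z"

locale nearring_with_identity = nearring R + monoid R for R (structure)

locale local_nearring = nearring_with_identity R for R (structure) +
  assumes nonunits_subgroup: "subgroup (carrier R - Units R) (add_monoid R)"


section \<open>Groups given by generators and relators\<close>

text \<open>
  A word is a list of letters; \<open>(x, True)\<close> stands for the generator \<open>x\<close> and
  \<open>(x, False)\<close> for its inverse. The generators are all elements of the type of letters.
\<close>

type_synonym 'g gword = "('g \<times> bool) list"

definition gen_word :: "'g \<Rightarrow> 'g gword" where
  "gen_word x = [(x, True)]"

definition word_inv :: "'g gword \<Rightarrow> 'g gword" where
  "word_inv w = rev (map (\<lambda>(x, s). (x, \<not> s)) w)"

definition word_pow :: "'g gword \<Rightarrow> nat \<Rightarrow> 'g gword" where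
  "word_pow w n = concat (replicate n w)"

text \<open>The commutator convention is \<open>[x, y] = x\<inverse> y\<inverse> x y\<close>.\<close>

definition word_comm :: "'g gword \<Rightarrow> 'g gword \<Rightarrow> 'g gword" where
  "word_comm u v = word_inv u @ word_inv v @ u @ v"

inductive word_eq :: "'g gword set \<Rightarrow> 'g gword \<Rightarrow> 'g gword \<Rightarrow> bool"
  for Rels :: "'g gword set" where
  refl: "word_eq Rels w w"
| sym: "word_eq Rels u v \<Longrightarrow> word_eq Rels v u"
| trans: "word_eq Rels u v \<Longrightarrow> word_eq Rels v w \<Longrightarrow> word_eq Rels u w"
| cancel: "word_eq Rels (u @ [(x, s), (x, \<not> s)] @ v) (u @ v)"
| relator: "r \<in> Rels \<Longrightarrow> word_eq Rels (u @ r @ v) (u @ v)"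

definition word_rel :: "'g gword set \<Rightarrow> ('g gword \<times> 'g gword) set" where
  "word_rel Rels = {(u, v). word_eq Rels u v}"

definition presented_group :: "'g gword set \<Rightarrow> 'g gword set monoid" where
  "presented_group Rels =
    \<lparr>carrier = UNIV // word_rel Rels,
     monoid.mult = (\<lambda>U V. \<Union>u\<in>U. \<Union>v\<in>V. word_rel Rels `` {u @ v}),
     monoid.one = word_rel Rels `` {[]}\<rparr>"

lemma equiv_word_rel: "equiv UNIV (word_rel Rels)"
  by (rule equivI)
    (auto simp: word_rel_def refl_on_def sym_def trans_def
      intro: word_eq.refl word_eq.sym word_eq.trans)

lemma word_eq_context: "word_eq Rels u v \<Longrightarrow> word_eq Rels (p @ u @ q) (p @ v @ q)"
proof (induction rule: word_eq.induct)
  case (cancel u x s v)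
  then show ?case using word_eq.cancel[of Rels "p @ u" x s "v @ q"] by simp
next
  case (relator r u v)
  then show ?case using word_eq.relator[of r Rels "p @ u" "v @ q"] by simp
qed (auto intro: word_eq.refl word_eq.sym word_eq.trans)

lemma word_eq_append:
  assumes "word_eq Rels u u'" "word_eq Rels v v'"
  shows "word_eq Rels (u @ v) (u' @ v')"
  using word_eq_context[OF assms(1), of "[]" v] word_eq_context[OF assms(2), of u' "[]"]
  by (auto intro: word_eq.trans)

lemma presented_group_mult:
  "word_rel Rels `` {u} \<otimes>\<^bsub>presented_group Rels\<^esub> word_rel Rels `` {v} = word_rel Rels `` {u @ v}"
proof -
  have "word_rel Rels `` {u @ v} = word_rel Rels `` {u' @ v'}"
    if "(u, u') \<in> word_rel Rels" "(v, v') \<in> word_rel Rels" for u u' v v'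
    using that by (intro equiv_class_eq[OF equiv_word_rel]) (simp add: word_rel_def word_eq_append)
  then have "(\<lambda>u v. word_rel Rels `` {u @ v}) respects2 word_rel Rels"
    unfolding congruent2_def by blast
  then show ?thesis
    by (simp add: presented_group_def UN_equiv_class2[OF equiv_word_rel equiv_word_rel])
qed

lemma word_inv_left: "word_eq Rels (word_inv w @ w) []"
proof (induction w)
  case Nil
  then show ?case by (simp add: word_inv_def word_eq.refl)
next
  case (Cons l w)
  obtain x s where l: "l = (x, s)" by (cases l)
  have "word_eq Rels (word_inv w @ [(x, \<not> s), (x, \<not> \<not> s)] @ w) (word_inv w @ w)"
    by (rule word_eq.cancel)
  then show ?case
    using Cons by (auto simp: l word_inv_def intro: word_eq.trans)
qed

lemma group_presented_group: "group (presented_group Rels)"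
proof (rule groupI)
  fix S T U
  assume "S \<in> carrier (presented_group Rels)" "T \<in> carrier (presented_group Rels)"
    "U \<in> carrier (presented_group Rels)"
  then obtain u v w where "S = word_rel Rels `` {u}" "T = word_rel Rels `` {v}"
    "U = word_rel Rels `` {w}"
    by (auto simp: presented_group_def quotient_def)
  then show "S \<otimes>\<^bsub>presented_group Rels\<^esub> T \<otimes>\<^bsub>presented_group Rels\<^esub> U =
    S \<otimes>\<^bsub>presented_group Rels\<^esub> (T \<otimes>\<^bsub>presented_group Rels\<^esub> U)"
    by (simp add: presented_group_mult)
next
  fix S T
  assume "S \<in> carrier (presented_group Rels)" "T \<in> carrier (presented_group Rels)"
  then obtain u v where "S = word_rel Rels `` {u}" "T = word_rel Rels `` {v}"
    by (auto simp: presented_group_def quotient_def)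
  then have "S \<otimes>\<^bsub>presented_group Rels\<^esub> T = word_rel Rels `` {u @ v}"
    by (simp add: presented_group_mult)
  then show "S \<otimes>\<^bsub>presented_group Rels\<^esub> T \<in> carrier (presented_group Rels)"
    by (auto simp: presented_group_def intro: quotientI)
next
  show "\<one>\<^bsub>presented_group Rels\<^esub> \<in> carrier (presented_group Rels)"
    by (auto simp: presented_group_def intro: quotientI)
next
  fix S
  assume "S \<in> carrier (presented_group Rels)"
  then obtain u where u: "S = word_rel Rels `` {u}"
    by (auto simp: presented_group_def quotient_def)
  have one: "\<one>\<^bsub>presented_group Rels\<^esub> = word_rel Rels `` {[]}"
    by (simp add: presented_group_def)
  show "\<one>\<^bsub>presented_group Rels\<^esub> \<otimes>\<^bsub>presented_group Rels\<^esub> S = S"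
    by (simp add: one u presented_group_mult)
  have "word_rel Rels `` {word_inv u} \<otimes>\<^bsub>presented_group Rels\<^esub> S = \<one>\<^bsub>presented_group Rels\<^esub>"
    unfolding one u presented_group_mult
    by (rule equiv_class_eq[OF equiv_word_rel]) (simp add: word_rel_def word_inv_left)
  moreover have "word_rel Rels `` {word_inv u} \<in> carrier (presented_group Rels)"
    by (auto simp: presented_group_def intro: quotientI)
  ultimately show "\<exists>T\<in>carrier (presented_group Rels).
      T \<otimes>\<^bsub>presented_group Rels\<^esub> S = \<one>\<^bsub>presented_group Rels\<^esub>"
    by blast
qed


section \<open>The group \<open>H\<^sub>1\<close>\<close>

datatype H1_gen = Gen_a | Gen_b

definition H1_relators :: "nat \<Rightarrow> H1_gen gword set" where
  "H1_relators p =
    (let a = gen_word Gen_a; b = gen_word Gen_b; c = word_comm a b in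
      {word_pow a p, word_pow b p, word_pow c p, word_pow (word_comm a c) p, word_comm b c,
       word_comm a (word_comm a c), word_comm b (word_comm a c)})"

definition H1 :: "nat \<Rightarrow> H1_gen gword set monoid" where
  "H1 p = presented_group (H1_relators p)"

end

theory Submission
  imports Defs "HOL-Algebra.Weak_Morphisms" "HOL-Number_Theory.Cong" "HOL-Library.Countable"
begin

text \<open>
  A left nearring with identity is the same as a group \<open>G\<close> with a distinguished element \<open>i\<close> and, for
  each \<open>x\<close> in \<open>G\<close>, an endomorphism \<open>\<lambda>\<^sub>x\<close> (left multiplication by \<open>x\<close>) that sends \<open>i\<close> to \<open>x\<close>, such that \<open>\<lambda>\<^sub>i\<close> is
  the identity and the composite of \<open>\<lambda>\<^sub>x\<close> and \<open>\<lambda>\<^sub>y\<close> is \<open>\<lambda>\<^sub>z\<close> for \<open>z = \<lambda>\<^sub>x y\<close>. For \<open>G = H\<^sub>1\<close> the choice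
  \<open>i = a\<close> works, because every element can be the image of \<open>a\<close> under an endomorphism with very simple
  effect on \<open>b\<close>. Let \<open>A\<close> be the abelian normal subgroup generated by \<open>b\<close>, \<open>c\<close> and
  \<open>d = [a, c]\<close>. For \<open>x\<close> outside \<open>A\<close>, let \<open>\<lambda>\<^sub>x\<close> send \<open>a\<close> to \<open>x\<close> and \<open>b\<close> to \<open>b\<close>; for
  \<open>x\<close> in \<open>A\<close>, let it send \<open>a\<close> to \<open>x\<close> and \<open>b\<close> to the neutral element. Such endomorphisms exist because
  \<open>H\<^sub>1\<close> has exponent \<open>p\<close> and every \<open>x\<close> acts on \<open>A\<close> as a power of \<open>a\<close> does. They compose as required,
  those of the first kind are bijective, and the non-units are exactly the elements of the subgroup \<open>A\<close>.

  To have formulas for these endomorphisms, \<open>H\<^sub>1\<close> is replaced by its Lie ring. As the class is \<open>3\<close> and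
  \<open>p > 3\<close>, the Baker--Campbell--Hausdorff series makes a Lie ring on quadruples modulo \<open>p\<close> into a group
  that satisfies the relations of \<open>H\<^sub>1\<close>, and endomorphisms of the Lie ring are endomorphisms of the
  group. In these coordinates the nearring product is an explicit polynomial apart from one indicator
  (\<open>mul4\<close>), and the nearring axioms become identities between integer expressions, valid at least
  modulo \<open>p\<close> (\<open>mul4_assoc\<close>, \<open>mul4_bch_distrib\<close>). An element is a unit if and only if its \<open>e\<^sub>0\<close> coordinate
  does not vanish modulo \<open>p\<close> (\<open>Units_H1_nearring\<close>).

  It remains to see that this group is \<open>H\<^sub>1\<close> itself and not a proper quotient
  (\<open>add_H1_nearring_iso_H1\<close>). In any group satisfying the relations each word in \<open>a\<close> and \<open>b\<close> can be
  collected to \<open>a\<^sup>i b\<^sup>j c\<^sup>k d\<^sup>l\<close> (\<open>word_eval_normal_form\<close>), and on such products the homomorphism from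
  \<open>H\<^sub>1\<close> given by von Dyck's theorem (\<open>presented_group_hom\<close>) is seen to be bijective.
\<close>

section \<open>A nearring on quadruples modulo a prime\<close>

type_synonym int4 = "int \<times> int \<times> int \<times> int"

text \<open>
  The Baker--Campbell--Hausdorff product \<open>X + Y + [X, Y]/2 + ([X, [X, Y]] - [Y, [X, Y]])/12\<close>
  of the Lie ring with basis \<open>e\<^sub>0, e\<^sub>1, e\<^sub>2, e\<^sub>3\<close> and nonzero brackets
  \<open>[e\<^sub>0, e\<^sub>1] = 2 e\<^sub>2\<close>, \<open>[e\<^sub>0, e\<^sub>2] = 6 e\<^sub>3\<close>. The factors \<open>2\<close> and \<open>6\<close> cancel the
  denominators, so that all computations can be done over the integers and reduced afterwards.
\<close>

fun bch :: "int4 \<Rightarrow> int4 \<Rightarrow> int4" where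
  "bch (k, x, y, z) (m, u, v, w) =
    (k + m, x + u, y + v + (k * u - m * x),
     z + w + 3 * (k * v - m * y) + (k - m) * (k * u - m * x))"

fun neg4 :: "int4 \<Rightarrow> int4" where
  "neg4 (k, x, y, z) = (- k, - x, - y, - z)"

text \<open>
  The residue \<open>1\<close> or \<open>0\<close> that tells units modulo \<open>q\<close> from non-units. It is multiplicative in \<open>k\<close>
  for prime \<open>q\<close>.
\<close>

definition nonzero_mod :: "int \<Rightarrow> int \<Rightarrow> int" where
  "nonzero_mod q k = of_bool (\<not> q dvd k)"

text \<open>
  For \<open>X = (k, x, y, z)\<close> the map \<open>mul4 q X\<close> is linear and sends \<open>e\<^sub>0\<close> to \<open>X\<close>, and \<open>e\<^sub>1\<close> to itself
  or to \<open>0\<close>. The rest is forced by compatibility with the bracket modulo \<open>q\<close>: from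
  \<open>[X, e\<^sub>1] = 2 k e\<^sub>2\<close> and \<open>[X, k e\<^sub>2] = 6 k\<^sup>2 e\<^sub>3\<close> it follows that \<open>e\<^sub>2 \<mapsto> k e\<^sub>2\<close> and \<open>e\<^sub>3 \<mapsto> k\<^sup>2 e\<^sub>3\<close>.
\<close>

fun mul4 :: "int \<Rightarrow> int4 \<Rightarrow> int4 \<Rightarrow> int4" where
  "mul4 q (k, x, y, z) (m, u, v, w) =
    (k * m, m * x + nonzero_mod q k * u, m * y + k * v, m * z + k\<^sup>2 * w)"

fun mod4 :: "int \<Rightarrow> int4 \<Rightarrow> int4" where
  "mod4 q (k, x, y, z) = (k mod q, x mod q, y mod q, z mod q)"

definition H1_nearring :: "int \<Rightarrow> int4 ring" where
  "H1_nearring q = \<lparr>carrier = range (mod4 q),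
     monoid.mult = (\<lambda>X Y. mod4 q (mul4 q X Y)), one = mod4 q (1, 0, 0, 0),
     zero = (0, 0, 0, 0), add = (\<lambda>X Y. mod4 q (bch X Y))\<rparr>"

lemma mod4_mod4 [simp]: "mod4 q (mod4 q X) = mod4 q X"
  by (cases X) simp

lemma dvd_fst_mod4: "q dvd fst (mod4 q X) \<longleftrightarrow> q dvd fst X"
  by (cases X) (simp add: dvd_mod_iff)

lemma fst_bch: "fst (bch X Y) = fst X + fst Y"
  by (cases X; cases Y) simp

lemma fst_neg4: "fst (neg4 X) = - fst X"
  by (cases X) simp

lemma mod4_eq_iff: "mod4 q (k, x, y, z) = mod4 q (m, u, v, w) \<longleftrightarrow>
    q dvd k - m \<and> q dvd x - u \<and> q dvd y - v \<and> q dvd z - w"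
  by (simp add: mod_eq_dvd_iff)

lemma mod4_cong:
  assumes "[k = m] (mod q)" "[x = u] (mod q)" "[y = v] (mod q)" "[z = w] (mod q)"
  shows "mod4 q (k, x, y, z) = mod4 q (m, u, v, w)"
  using assms by (simp add: cong_def)

lemma nonzero_mod_mod [simp]: "nonzero_mod q (k mod q) = nonzero_mod q k"
  by (simp add: nonzero_mod_def dvd_mod_iff)

lemma nonzero_mod_mult: "prime q \<Longrightarrow> nonzero_mod q (k * m) = nonzero_mod q k * nonzero_mod q m"
  by (simp add: nonzero_mod_def prime_dvd_mult_iff)

lemma mult_nonzero_mod: "[k * nonzero_mod q k = k] (mod q)"
  by (auto simp: nonzero_mod_def cong_def)

lemma mod4_bch: "mod4 q (bch (mod4 q X) Y) = mod4 q (bch X Y)"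
  "mod4 q (bch X (mod4 q Y)) = mod4 q (bch X Y)"
proof -
  obtain k x y z where X: "X = (k, x, y, z)" by (metis prod.exhaust)
  obtain m u v w where Y: "Y = (m, u, v, w)" by (metis prod.exhaust)
  show "mod4 q (bch (mod4 q X) Y) = mod4 q (bch X Y)"
    "mod4 q (bch X (mod4 q Y)) = mod4 q (bch X Y)"
    unfolding X Y mod4.simps[of q k] mod4.simps[of q m] bch.simps
    by (intro mod4_cong cong_add cong_mult cong_diff; simp add: cong_def)+
qed

lemma mod4_mul4: "mod4 q (mul4 q (mod4 q X) Y) = mod4 q (mul4 q X Y)"
  "mod4 q (mul4 q X (mod4 q Y)) = mod4 q (mul4 q X Y)"
proof -
  obtain k x y z where X: "X = (k, x, y, z)" by (metis prod.exhaust)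
  obtain m u v w where Y: "Y = (m, u, v, w)" by (metis prod.exhaust)
  show "mod4 q (mul4 q (mod4 q X) Y) = mod4 q (mul4 q X Y)"
    "mod4 q (mul4 q X (mod4 q Y)) = mod4 q (mul4 q X Y)"
    unfolding X Y mod4.simps[of q k] mod4.simps[of q m] mul4.simps nonzero_mod_mod
    by (intro mod4_cong cong_add cong_mult cong_pow; simp add: cong_def)+
qed

lemma bch_assoc: "bch (bch X Y) Z = bch X (bch Y Z)"
  by (cases X; cases Y; cases Z) (simp add: algebra_simps)

lemma bch_neg4: "bch (neg4 X) X = (0, 0, 0, 0)"
  by (cases X) simp

text \<open>
  Both sides apply a linear map to \<open>Z\<close>, so the basis vectors can be treated separately. The maps agree
  on \<open>e\<^sub>0\<close> by definition; the other basis vectors are multiplied by scalars, which behave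
  multiplicatively, on \<open>e\<^sub>1\<close> because \<open>q\<close> is prime.
\<close>

lemma mul4_assoc: "prime q \<Longrightarrow> mul4 q (mul4 q X Y) Z = mul4 q X (mul4 q Y Z)"
  by (cases X; cases Y; cases Z) (simp add: algebra_simps power2_eq_square nonzero_mod_mult)

text \<open>
  A linear map that respects the Lie bracket respects the Baker--Campbell--Hausdorff product. Over the
  integers the bracket is respected only up to the difference between \<open>k * nonzero_mod q k\<close> and
  \<open>k\<close>, which is a multiple \<open>q * t\<close> of \<open>q\<close>.
\<close>

lemma mul4_bch_distrib: "mod4 q (mul4 q X (bch Y Z)) = mod4 q (bch (mul4 q X Y) (mul4 q X Z))"
proof -
  obtain k x y z where X: "X = (k, x, y, z)" by (metis prod.exhaust)
  obtain m u v w where Y: "Y = (m, u, v, w)" by (metis prod.exhaust)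
  obtain m' u' v' w' where Z: "Z = (m', u', v', w')" by (metis prod.exhaust)
  obtain t where "k * nonzero_mod q k - k = q * t"
    using mult_nonzero_mod[of k q] by (auto simp: cong_iff_dvd_diff)
  then have t: "k * nonzero_mod q k = k + q * t" by simp
  define e where "e = nonzero_mod q k"
  let ?D = "m * u' - m' * u"
  have "k * m * (m' * x + e * u') - k * m' * (m * x + e * u) = (k * e) * ?D"
    by (simp add: algebra_simps)
  then have 1: "k * m * (m' * x + e * u') - k * m' * (m * x + e * u) = (k + q * t) * ?D"
    using t by (simp add: e_def)
  show ?thesis
    unfolding X Y Z bch.simps mul4.simps e_def[symmetric]
  proof (subst mod4_eq_iff, unfold 1, intro conjI)
    show "q dvd k * (m + m') - (k * m + k * m')"
      by (simp add: algebra_simps)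
    show "q dvd (m + m') * x + e * (u + u') - (m * x + e * u + (m' * x + e * u'))"
      by (simp add: algebra_simps)
    have "(m + m') * y + k * (v + v' + ?D) - (m * y + k * v + (m' * y + k * v') + (k + q * t) * ?D)
        = q * (- t * ?D)"
      by (simp add: algebra_simps power2_eq_square)
    then show "q dvd (m + m') * y + k * (v + v' + ?D)
        - (m * y + k * v + (m' * y + k * v') + (k + q * t) * ?D)"
      by (rule dvdI)
    have "(m + m') * z + k\<^sup>2 * (w + w' + 3 * (m * v' - m' * v) + (m - m') * ?D) -
        (m * z + k\<^sup>2 * w + (m' * z + k\<^sup>2 * w') +
          3 * (k * m * (m' * y + k * v') - k * m' * (m * y + k * v)) +
          (k * m - k * m') * ((k + q * t) * ?D)) = q * (- t * ?D * k * (m - m'))"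
      by (simp add: algebra_simps power2_eq_square)
    then show "q dvd (m + m') * z + k\<^sup>2 * (w + w' + 3 * (m * v' - m' * v) + (m - m') * ?D) -
        (m * z + k\<^sup>2 * w + (m' * z + k\<^sup>2 * w') +
          3 * (k * m * (m' * y + k * v') - k * m' * (m * y + k * v)) +
          (k * m - k * m') * ((k + q * t) * ?D))"
      by (rule dvdI)
  qed
qed

lemma group_add_H1_nearring: "group (add_monoid (H1_nearring q))"
proof (rule groupI)
  fix X Y Z :: int4
  show "X \<otimes>\<^bsub>add_monoid (H1_nearring q)\<^esub> Y \<otimes>\<^bsub>add_monoid (H1_nearring q)\<^esub> Z =
      X \<otimes>\<^bsub>add_monoid (H1_nearring q)\<^esub> (Y \<otimes>\<^bsub>add_monoid (H1_nearring q)\<^esub> Z)"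
    by (simp add: H1_nearring_def mod4_bch bch_assoc)
  show "X \<otimes>\<^bsub>add_monoid (H1_nearring q)\<^esub> Y \<in> carrier (add_monoid (H1_nearring q))"
    by (simp add: H1_nearring_def)
  have "mod4 q (0, 0, 0, 0) = (0, 0, 0, 0)" by simp
  then show "\<one>\<^bsub>add_monoid (H1_nearring q)\<^esub> \<in> carrier (add_monoid (H1_nearring q))"
    unfolding H1_nearring_def by (metis monoid.select_convs(2) partial_object.select_convs(1) rangeI ring.select_convs(1))
next
  fix X assume "X \<in> carrier (add_monoid (H1_nearring q))"
  then obtain Y where X: "X = mod4 q Y" by (auto simp: H1_nearring_def)
  show "\<one>\<^bsub>add_monoid (H1_nearring q)\<^esub> \<otimes>\<^bsub>add_monoid (H1_nearring q)\<^esub> X = X"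
    by (cases Y) (simp add: X H1_nearring_def)
  have "mod4 q (neg4 Y) \<otimes>\<^bsub>add_monoid (H1_nearring q)\<^esub> X = \<one>\<^bsub>add_monoid (H1_nearring q)\<^esub>"
    by (simp add: X H1_nearring_def mod4_bch bch_neg4)
  moreover have "mod4 q (neg4 Y) \<in> carrier (add_monoid (H1_nearring q))"
    by (simp add: H1_nearring_def)
  ultimately show "\<exists>Z\<in>carrier (add_monoid (H1_nearring q)). Z \<otimes>\<^bsub>add_monoid (H1_nearring q)\<^esub> X = \<one>\<^bsub>add_monoid (H1_nearring q)\<^esub>"
    by blast
qed

lemma nearring_with_identity_H1_nearring:
  assumes "prime q"
  shows "nearring_with_identity (H1_nearring q)"
proof (intro nearring_with_identity.intro nearring.intro group_add_H1_nearring monoid.intro)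
  show "X \<otimes>\<^bsub>H1_nearring q\<^esub> (Y \<oplus>\<^bsub>H1_nearring q\<^esub> Z) = X \<otimes>\<^bsub>H1_nearring q\<^esub> Y \<oplus>\<^bsub>H1_nearring q\<^esub> X \<otimes>\<^bsub>H1_nearring q\<^esub> Z" for X Y Z
    by (simp add: H1_nearring_def mod4_bch mod4_mul4 mul4_bch_distrib)
  show "X \<otimes>\<^bsub>H1_nearring q\<^esub> Y \<otimes>\<^bsub>H1_nearring q\<^esub> Z = X \<otimes>\<^bsub>H1_nearring q\<^esub> (Y \<otimes>\<^bsub>H1_nearring q\<^esub> Z)" for X Y Z
    by (simp add: H1_nearring_def mod4_mul4 mul4_assoc assms)
  then show "X \<otimes>\<^bsub>H1_nearring q\<^esub> Y \<otimes>\<^bsub>H1_nearring q\<^esub> Z = X \<otimes>\<^bsub>H1_nearring q\<^esub> (Y \<otimes>\<^bsub>H1_nearring q\<^esub> Z)" for X Y Z .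
  have "nonzero_mod q 1 = 1"
    using assms by (auto simp: nonzero_mod_def)
  then have one: "mul4 q (1, 0, 0, 0) Y = Y" "mul4 q Y (1, 0, 0, 0) = Y" for Y
    by (cases Y; simp)+
  fix X assume "X \<in> carrier (H1_nearring q)"
  then obtain Y where X: "X = mod4 q Y" by (auto simp: H1_nearring_def)
  show "\<one>\<^bsub>H1_nearring q\<^esub> \<otimes>\<^bsub>H1_nearring q\<^esub> X = X" "X \<otimes>\<^bsub>H1_nearring q\<^esub> \<one>\<^bsub>H1_nearring q\<^esub> = X"
    by (simp_all add: H1_nearring_def X mod4_mul4 one del: mod4.simps)
qed (auto simp: H1_nearring_def simp del: mod4.simps)

text \<open>
  The first coordinate is a multiplicative homomorphism to the integers modulo \<open>q\<close>, so it has to be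
  invertible in a unit. Conversely, left multiplication by \<open>X\<close> is then given by a triangular matrix
  with diagonal entries \<open>k, 1, k, k\<^sup>2\<close>, and solving \<open>X Y = 1\<close> gives the explicit inverse used below.
\<close>

lemma Units_H1_nearring:
  assumes "prime q"
  shows "Units (H1_nearring q) = {X \<in> carrier (H1_nearring q). \<not> q dvd fst X}"
proof (intro equalityI subsetI)
  fix X assume "X \<in> Units (H1_nearring q)"
  then obtain Y where X: "X \<in> carrier (H1_nearring q)" and "X \<otimes>\<^bsub>H1_nearring q\<^esub> Y = \<one>\<^bsub>H1_nearring q\<^esub>"
    by (auto simp: Units_def)
  then have "[fst X * fst Y = 1] (mod q)"
    by (cases X; cases Y) (simp add: H1_nearring_def cong_def)
  then have "\<not> q dvd fst X"
    using assms by (metis cong_dvd_iff dvd_mult2 not_prime_unit)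
  then show "X \<in> {X \<in> carrier (H1_nearring q). \<not> q dvd fst X}"
    using X by simp
next
  fix X assume X: "X \<in> {X \<in> carrier (H1_nearring q). \<not> q dvd fst X}"
  obtain k x y z where X': "X = (k, x, y, z)" by (metis prod.exhaust)
  from X have "\<not> q dvd k" by (simp add: X')
  then have "coprime k q"
    using prime_imp_coprime[OF assms] coprime_commute by blast
  then obtain m where "[k * m = 1] (mod q)"
    using cong_solve_coprime_int by blast
  then obtain t where "k * m - 1 = q * t" by (auto simp: cong_iff_dvd_diff)
  then have t: "k * m = 1 + q * t" by simp
  have e: "nonzero_mod q k = 1" using X by (simp add: X' nonzero_mod_def)
  have "\<not> q dvd m"
  proof
    assume "q dvd m"
    then have "q dvd k * m - q * t" by simp
    then have "q dvd 1" using t by simp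
    then show False using assms not_prime_unit by blast
  qed
  then have e': "nonzero_mod q m = 1" by (simp add: nonzero_mod_def)
  define Y where "Y = (m, - (m * x), - (m\<^sup>2 * y), - (m ^ 3 * z))"
  have inverse: "q dvd 1 - k * m" using t by simp
  have "mod4 q (mul4 q X Y) = mod4 q (1, 0, 0, 0)"
    unfolding X' Y_def mul4.simps mod4_eq_iff e
  proof (intro conjI)
    show "q dvd k * m - 1" using t by simp
    have "m * y + k * - (m\<^sup>2 * y) - 0 = (1 - k * m) * (m * y)"
      by (simp add: algebra_simps power2_eq_square power3_eq_cube)
    then show "q dvd m * y + k * - (m\<^sup>2 * y) - 0"
      using inverse by simp
    have "m * z + k\<^sup>2 * - (m ^ 3 * z) - 0 = (1 - k * m) * ((1 + k * m) * m * z)"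
      by (simp add: algebra_simps power2_eq_square power3_eq_cube)
    then show "q dvd m * z + k\<^sup>2 * - (m ^ 3 * z) - 0"
      using inverse by simp
  qed simp
  moreover have "mod4 q (mul4 q Y X) = mod4 q (1, 0, 0, 0)"
    unfolding X' Y_def mul4.simps mod4_eq_iff e'
  proof (intro conjI)
    show "q dvd m * k - 1" using t by (simp add: mult.commute)
    have "k * - (m * x) + 1 * x - 0 = (1 - k * m) * x"
      by (simp add: algebra_simps power2_eq_square power3_eq_cube)
    then show "q dvd k * - (m * x) + 1 * x - 0"
      using inverse by simp
    have "k * - (m\<^sup>2 * y) + m * y - 0 = (1 - k * m) * (m * y)"
      by (simp add: algebra_simps power2_eq_square power3_eq_cube)
    then show "q dvd k * - (m\<^sup>2 * y) + m * y - 0"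
      using inverse by simp
    have "k * - (m ^ 3 * z) + m\<^sup>2 * z - 0 = (1 - k * m) * (m\<^sup>2 * z)"
      by (simp add: algebra_simps power2_eq_square power3_eq_cube)
    then show "q dvd k * - (m ^ 3 * z) + m\<^sup>2 * z - 0"
      using inverse by simp
  qed
  ultimately have "X \<otimes>\<^bsub>H1_nearring q\<^esub> mod4 q Y = \<one>\<^bsub>H1_nearring q\<^esub>" "mod4 q Y \<otimes>\<^bsub>H1_nearring q\<^esub> X = \<one>\<^bsub>H1_nearring q\<^esub>"
    by (simp_all add: H1_nearring_def mod4_mul4 del: mod4.simps mul4.simps)
  moreover have "mod4 q Y \<in> carrier (H1_nearring q)"
    by (simp add: H1_nearring_def)
  ultimately show "X \<in> Units (H1_nearring q)"
    using X unfolding Units_def by blast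
qed

text \<open>
  The non-units form the kernel of the first coordinate, which is a homomorphism on the additive
  group.
\<close>

lemma local_nearring_H1_nearring:
  assumes "prime q"
  shows "local_nearring (H1_nearring q)"
proof (intro local_nearring.intro local_nearring_axioms.intro nearring_with_identity_H1_nearring assms)
  interpret add: group "add_monoid (H1_nearring q)" by (rule group_add_H1_nearring)
  have L: "carrier (H1_nearring q) - Units (H1_nearring q) = {X \<in> carrier (H1_nearring q). q dvd fst X}"
    using Units_H1_nearring[OF assms] by auto
  show "subgroup (carrier (H1_nearring q) - Units (H1_nearring q)) (add_monoid (H1_nearring q))"
    unfolding L
  proof (rule add.subgroupI)
    have "(0, 0, 0, 0) \<in> carrier (H1_nearring q)"
      using add.one_closed by (simp add: H1_nearring_def)
    then show "{X \<in> carrier (H1_nearring q). q dvd fst X} \<noteq> {}"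
      by (metis (mono_tags, lifting) dvd_0_right empty_iff fst_conv mem_Collect_eq)
    fix X assume X: "X \<in> {X \<in> carrier (H1_nearring q). q dvd fst X}"
    have "mod4 q (neg4 X) \<oplus>\<^bsub>H1_nearring q\<^esub> X = \<zero>\<^bsub>H1_nearring q\<^esub>"
      by (simp add: H1_nearring_def mod4_bch bch_neg4)
    then have "inv\<^bsub>add_monoid (H1_nearring q)\<^esub> X = mod4 q (neg4 X)"
      using X by (intro add.inv_equality) (auto simp: H1_nearring_def)
    then show "inv\<^bsub>add_monoid (H1_nearring q)\<^esub> X \<in> {X \<in> carrier (H1_nearring q). q dvd fst X}"
      using X by (simp add: H1_nearring_def dvd_fst_mod4 fst_neg4)
  next
    fix X Y assume "X \<in> {X \<in> carrier (H1_nearring q). q dvd fst X}" "Y \<in> {X \<in> carrier (H1_nearring q). q dvd fst X}"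
    then show "X \<otimes>\<^bsub>add_monoid (H1_nearring q)\<^esub> Y \<in> {X \<in> carrier (H1_nearring q). q dvd fst X}"
      by (simp add: H1_nearring_def dvd_fst_mod4 fst_bch)
  qed auto
qed

section \<open>Transport along an injection\<close>

lemma local_nearring_image_ring:
  assumes "local_nearring R" and inj: "inj_on f (carrier R)"
  shows "local_nearring (image_ring f R)" and "add_monoid (image_ring f R) \<cong> add_monoid R"
proof -
  interpret local_nearring R by fact
  interpret add: group "add_monoid R" by (rule add_group)
  let ?S = "image_ring f R"
  have carr: "carrier ?S = f ` carrier R"
    by (rule image_ring_carrier)
  have one: "\<one>\<^bsub>?S\<^esub> = f \<one>\<^bsub>R\<^esub>" by (rule image_ring_one)
  have mult: "f x \<otimes>\<^bsub>?S\<^esub> f y = f (x \<otimes>\<^bsub>R\<^esub> y)" and add: "f x \<oplus>\<^bsub>?S\<^esub> f y = f (x \<oplus>\<^bsub>R\<^esub> y)"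
    if "x \<in> carrier R" "y \<in> carrier R" for x y
    using that inj by (simp_all add: image_ring_def image_group_def monoid.defs)
  have add_closed: "x \<oplus>\<^bsub>R\<^esub> y \<in> carrier R" if "x \<in> carrier R" "y \<in> carrier R" for x y
    using that add.m_closed by simp
  have hom: "f \<in> iso (add_monoid R) (add_monoid ?S)"
    using inj by (auto simp: iso_def hom_def bij_betw_def add carr add_closed)
  have "group (add_monoid ?S\<lparr>one := f \<one>\<^bsub>add_monoid R\<^esub>\<rparr>)"
    using add.iso_imp_img_group[OF hom] by simp
  then have grp: "group (add_monoid ?S)"
    by (simp add: image_ring_zero)
  interpret h: group_hom "add_monoid R" "add_monoid ?S" f
    using grp hom by (simp add: group_hom_def group_hom_axioms_def add.group_axioms iso_def)
  show "add_monoid ?S \<cong> add_monoid R"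
    using add.iso_sym[OF is_isoI[OF hom]] .
  have "Units ?S = f ` Units R"
  proof -
    have "f x \<in> Units ?S \<longleftrightarrow> x \<in> Units R" if "x \<in> carrier R" for x
      using that inj by (auto simp: Units_def carr one mult inj_on_eq_iff)
    moreover have "Units ?S \<subseteq> f ` carrier R"
      by (auto simp: Units_def carr)
    ultimately show ?thesis
      using Units_closed by blast
  qed
  then have "carrier ?S - Units ?S = f ` (carrier R - Units R)"
    using inj by (auto simp: carr inj_on_image_set_diff[of f "carrier R"] Units_closed subsetI)
  then have "subgroup (carrier ?S - Units ?S) (add_monoid ?S)"
    using h.subgroup_img_is_subgroup[OF nonunits_subgroup] by simp
  then show "local_nearring ?S"
    by (intro local_nearring.intro local_nearring_axioms.intro nearring_with_identity.intro
        nearring.intro monoid.intro grp)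
      (auto simp: carr one mult add add_closed mult_assoc left_distrib m_assoc)
qed

section \<open>Homomorphisms out of a presented group\<close>

definition word_eval :: "('a, 'm) monoid_scheme \<Rightarrow> ('g \<Rightarrow> 'a) \<Rightarrow> 'g gword \<Rightarrow> 'a" where
  "word_eval G f w =
    foldr (\<lambda>(x, s) y. (if s then f x else inv\<^bsub>G\<^esub> f x) \<otimes>\<^bsub>G\<^esub> y) w \<one>\<^bsub>G\<^esub>"

text \<open>
  The convention is that of \<open>word_comm\<close>. The product is bracketed to the right because words are
  evaluated from the right.
\<close>

definition commutator :: "('a, 'm) monoid_scheme \<Rightarrow> 'a \<Rightarrow> 'a \<Rightarrow> 'a" where
  "commutator G x y = inv\<^bsub>G\<^esub> x \<otimes>\<^bsub>G\<^esub> (inv\<^bsub>G\<^esub> y \<otimes>\<^bsub>G\<^esub> (x \<otimes>\<^bsub>G\<^esub> y))"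

lemma word_eval_Nil [simp]: "word_eval G f [] = \<one>\<^bsub>G\<^esub>"
  by (simp add: word_eval_def)

lemma word_eval_Cons [simp]:
  "word_eval G f ((x, s) # w) = (if s then f x else inv\<^bsub>G\<^esub> f x) \<otimes>\<^bsub>G\<^esub> word_eval G f w"
  by (simp add: word_eval_def)

context group
begin

lemma commutator_closed [simp, intro]:
  "\<lbrakk>x \<in> carrier G; y \<in> carrier G\<rbrakk> \<Longrightarrow> commutator G x y \<in> carrier G"
  by (simp add: commutator_def)

lemma mult_commutator:
  assumes "x \<in> carrier G" "y \<in> carrier G"
  shows "y \<otimes> (x \<otimes> commutator G x y) = x \<otimes> y"
  using assms by (simp add: commutator_def inv_solve_left m_assoc[symmetric])

lemma mult_eq_mult_inv_commutator:
  assumes "x \<in> carrier G" "y \<in> carrier G"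
  shows "y \<otimes> x = x \<otimes> (y \<otimes> inv commutator G x y)"
proof -
  have "y \<otimes> x = y \<otimes> (x \<otimes> commutator G x y) \<otimes> inv commutator G x y"
    using assms by (simp add: m_assoc r_inv)
  then show ?thesis
    using assms by (simp add: mult_commutator m_assoc)
qed

lemma commutator_eq_one_iff:
  assumes "x \<in> carrier G" "y \<in> carrier G"
  shows "commutator G x y = \<one> \<longleftrightarrow> x \<otimes> y = y \<otimes> x"
proof -
  have "commutator G x y = \<one> \<longleftrightarrow> (y \<otimes> x) \<otimes> commutator G x y = y \<otimes> x"
    using assms by simp
  also have "(y \<otimes> x) \<otimes> commutator G x y = x \<otimes> y"
    using assms by (simp add: mult_commutator m_assoc)
  finally show ?thesis .
qed

text \<open>
  Moving \<open>z\<close> leftwards past a power of \<open>x\<close>, when passing a single \<open>x\<close> turns it into \<open>y\<close>; the case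
  \<open>x = y\<close> says that \<open>z\<close> commutes with the powers of \<open>x\<close>.
\<close>

lemma pow_push:
  assumes "x \<in> carrier G" "y \<in> carrier G" "z \<in> carrier G" and "x \<otimes> z = z \<otimes> y"
  shows "x [^] (n::nat) \<otimes> z = z \<otimes> y [^] n"
proof (induction n)
  case (Suc n)
  have "x [^] Suc n \<otimes> z = x [^] n \<otimes> z \<otimes> y"
    using assms by (simp add: m_assoc)
  then show ?case
    using assms by (simp add: Suc m_assoc)
qed (use assms in simp)

lemma pow_dvd_eq_one:
  assumes "x \<in> carrier G" "x [^] (p::nat) = \<one>" "p dvd n"
  shows "x [^] n = \<one>"
  using assms by (auto simp: dvd_def simp flip: nat_pow_pow)

lemma inv_eq_pow:
  assumes "x \<in> carrier G" "x [^] (p::nat) = \<one>" "p > 0"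
  shows "inv x = x [^] (p - 1)"
proof (rule inv_equality)
  have "x [^] (p - 1) \<otimes> x = x [^] Suc (p - 1)" by simp
  then show "x [^] (p - 1) \<otimes> x = \<one>" using assms by simp
qed (use assms in auto)

context
  fixes f :: "'g \<Rightarrow> 'a"
  assumes f: "\<And>x. f x \<in> carrier G"
begin

lemma word_eval_closed [simp, intro]: "word_eval G f w \<in> carrier G"
  by (induction w) (auto simp: f)

lemma word_eval_append: "word_eval G f (u @ v) = word_eval G f u \<otimes> word_eval G f v"
  by (induction u) (auto simp: f m_assoc)

lemma word_eval_gen_word: "word_eval G f (gen_word x) = f x"
  by (simp add: gen_word_def f)

lemma word_eval_word_inv: "word_eval G f (word_inv w) = inv word_eval G f w"
  by (induction w) (auto simp: word_inv_def word_eval_append f inv_mult_group)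

lemma word_eval_word_pow: "word_eval G f (word_pow w n) = word_eval G f w [^] n"
proof (induction n)
  case (Suc n)
  then show ?case
    using nat_pow_Suc2[of "word_eval G f w" n] by (simp add: word_pow_def word_eval_append)
qed (simp add: word_pow_def)

lemma word_eval_word_comm:
  "word_eval G f (word_comm u v) = commutator G (word_eval G f u) (word_eval G f v)"
  by (simp add: word_comm_def commutator_def word_eval_append word_eval_word_inv)

lemma word_eval_word_eq:
  assumes "\<And>r. r \<in> Rels \<Longrightarrow> word_eval G f r = \<one>" and "word_eq Rels u v"
  shows "word_eval G f u = word_eval G f v"
  using assms(2)
proof induction
  case (cancel u x s v)
  have "word_eval G f [(x, s), (x, \<not> s)] = \<one>"
    by (simp add: f)
  then show ?case
    by (simp only: word_eval_append l_one r_one word_eval_closed)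
qed (simp_all add: word_eval_append assms(1))

text \<open>
  This is von Dyck's theorem: evaluation respects the defining relation on words as soon as it kills
  the relators.
\<close>

lemma presented_group_hom:
  assumes "\<And>r. r \<in> Rels \<Longrightarrow> word_eval G f r = \<one>"
  obtains h where "group_hom (presented_group Rels) G h"
    and "\<And>w. h (word_rel Rels `` {w}) = word_eval G f w"
proof -
  define h where "h U = the_elem (word_eval G f ` U)" for U
  have h: "h (word_rel Rels `` {w}) = word_eval G f w" for w
  proof -
    have "word_eval G f ` (word_rel Rels `` {w}) = {word_eval G f w}"
      using word_eval_word_eq[OF assms] by (auto simp: word_rel_def intro: word_eq.refl)
    then show ?thesis by (simp add: h_def)
  qed
  have carr: "\<exists>w. U = word_rel Rels `` {w}" if "U \<in> carrier (presented_group Rels)" for U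
    using that by (auto simp: presented_group_def quotient_def)
  have "h \<in> hom (presented_group Rels) G"
  proof (rule homI)
    fix U V assume U: "U \<in> carrier (presented_group Rels)" and V: "V \<in> carrier (presented_group Rels)"
    from carr[OF U] carr[OF V] show "h (U \<otimes>\<^bsub>presented_group Rels\<^esub> V) = h U \<otimes> h V"
      by (auto simp: presented_group_mult h word_eval_append)
  next
    fix U assume U: "U \<in> carrier (presented_group Rels)"
    from carr[OF U] show "h U \<in> carrier G" by (auto simp: h)
  qed
  then have "group_hom (presented_group Rels) G h"
    by (simp add: group_hom_def group_hom_axioms_def group_presented_group group_axioms)
  then show ?thesis using h that by blast
qed

end

end

lemma class_in_presented_group [simp, intro]:
  "word_rel Rels `` {w} \<in> carrier (presented_group Rels)"
  by (auto simp: presented_group_def intro: quotientI)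

lemma presented_group_cases:
  assumes "U \<in> carrier (presented_group Rels)"
  obtains w where "U = word_rel Rels `` {w}"
  using assms by (auto simp: presented_group_def quotient_def)

lemma class_eq_iff: "word_rel Rels `` {u} = word_rel Rels `` {v} \<longleftrightarrow> word_eq Rels u v"
  using eq_equiv_class_iff[OF equiv_word_rel, of u v Rels] by (simp add: word_rel_def)

lemma presented_group_one: "\<one>\<^bsub>presented_group Rels\<^esub> = word_rel Rels `` {[]}"
  by (simp add: presented_group_def)

text \<open>
  The class of a word is the value of that word at the classes of the generators. Hence facts about
  \<open>word_eval\<close> in an arbitrary group apply to the presented group itself.
\<close>

lemma class_eq_word_eval:
  "word_rel Rels `` {w} = word_eval (presented_group Rels) (\<lambda>x. word_rel Rels `` {gen_word x}) w"
proof (induction w)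
  case Nil
  then show ?case by (simp add: presented_group_one)
next
  case (Cons l w)
  obtain x s where l: "l = (x, s)" by (cases l)
  interpret group "presented_group Rels" by (rule group_presented_group)
  have "word_eq Rels ([] @ [(x, False), (x, \<not> False)] @ []) ([] @ [])"
    by (rule word_eq.cancel)
  then have "word_rel Rels `` {[(x, False)]} \<otimes>\<^bsub>presented_group Rels\<^esub> word_rel Rels `` {gen_word x}
      = \<one>\<^bsub>presented_group Rels\<^esub>"
    by (simp add: presented_group_mult presented_group_one class_eq_iff gen_word_def)
  then have "inv\<^bsub>presented_group Rels\<^esub> (word_rel Rels `` {gen_word x}) = word_rel Rels `` {[(x, False)]}"
    by (intro inv_equality) auto
  then have "word_rel Rels `` {[l]} = (if s then word_rel Rels `` {gen_word x}
      else inv\<^bsub>presented_group Rels\<^esub> (word_rel Rels `` {gen_word x}))"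
    by (simp add: l gen_word_def)
  then have "word_eval (presented_group Rels) (\<lambda>x. word_rel Rels `` {gen_word x}) (l # w) =
      word_rel Rels `` {[l]} \<otimes>\<^bsub>presented_group Rels\<^esub> word_rel Rels `` {w}"
    by (simp add: l Cons.IH)
  then show ?case by (simp add: presented_group_mult)
qed

section \<open>Normal forms in groups satisfying the relations\<close>

definition normal_word :: "nat \<Rightarrow> nat \<Rightarrow> nat \<Rightarrow> nat \<Rightarrow> H1_gen gword" where
  "normal_word i j k l =
    (let a = gen_word Gen_a; b = gen_word Gen_b; c = word_comm a b; d = word_comm a c in
      word_pow a i @ word_pow b j @ word_pow c k @ word_pow d l)"

lemma (in group) word_eval_normal_word:
  fixes f
  defines "a \<equiv> f Gen_a" and "b \<equiv> f Gen_b"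
  assumes f: "\<And>x. f x \<in> carrier G"
  shows "word_eval G f (normal_word i j k l) =
    a [^] i \<otimes> (b [^] j \<otimes> (commutator G a b [^] k \<otimes> commutator G a (commutator G a b) [^] l))"
  by (simp add: normal_word_def Let_def f word_eval_append word_eval_word_pow word_eval_word_comm
      word_eval_gen_word a_def b_def)

text \<open>
  The relators as equations between group elements: a trivial commutator means that two elements
  commute.
\<close>

lemma (in group) H1_relators_eval_iff:
  fixes f
  defines "a \<equiv> f Gen_a" and "b \<equiv> f Gen_b"
  defines "c \<equiv> commutator G a b"
  defines "d \<equiv> commutator G a c"
  assumes f: "\<And>x. f x \<in> carrier G"
  shows "(\<forall>r \<in> H1_relators p. word_eval G f r = \<one>) \<longleftrightarrow>
    a [^] p = \<one> \<and> b [^] p = \<one> \<and> c [^] p = \<one> \<and> d [^] p = \<one> \<and>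
    b \<otimes> c = c \<otimes> b \<and> a \<otimes> d = d \<otimes> a \<and> b \<otimes> d = d \<otimes> b"
  by (simp add: H1_relators_def Let_def f word_eval_word_pow word_eval_word_comm
      word_eval_gen_word a_def b_def c_def d_def commutator_eq_one_iff)

lemma (in group) word_eval_normal_word_dvd:
  assumes f: "\<And>x. f x \<in> carrier G"
    and rels: "\<And>r. r \<in> H1_relators p \<Longrightarrow> word_eval G f r = \<one>"
    and dvd: "p dvd i" "p dvd j" "p dvd k" "p dvd l"
  shows "word_eval G f (normal_word i j k l) = \<one>"
proof -
  have "\<forall>r\<in>H1_relators p. word_eval G f r = \<one>"
    using rels by blast
  then have "f Gen_a [^] p = \<one>" "f Gen_b [^] p = \<one>"
    "commutator G (f Gen_a) (f Gen_b) [^] p = \<one>"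
    "commutator G (f Gen_a) (commutator G (f Gen_a) (f Gen_b)) [^] p = \<one>"
    unfolding H1_relators_eval_iff[of f p, OF f] by blast+
  from this[THEN pow_dvd_eq_one[rotated]] dvd show ?thesis
    by (simp add: word_eval_normal_word f)
qed

text \<open>
  A collection process: the set of products \<open>a\<^sup>i b\<^sup>j c\<^sup>k d\<^sup>l\<close> contains \<open>1\<close> and is closed under right
  multiplication by \<open>a\<close> and \<open>b\<close>. The letter \<open>b\<close> commutes with \<open>c\<close> and \<open>d\<close>; moving \<open>a\<close> to the left past
  \<open>b\<close> and \<open>c\<close> creates factors \<open>c\<^sup>-\<^sup>1\<close> and \<open>d\<^sup>-\<^sup>1\<close>, and these can be absorbed because \<open>c\<close> and \<open>d\<close> commute
  with \<open>b\<close> and with each other. As the generators have finite order, their inverses are powers, and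
  natural exponents suffice.
\<close>

lemma (in group) word_eval_normal_form:
  assumes f: "\<And>x. f x \<in> carrier G" and p: "p > 0"
    and rels: "\<And>r. r \<in> H1_relators p \<Longrightarrow> word_eval G f r = \<one>"
  shows "\<exists>i j k l. word_eval G f w = word_eval G f (normal_word i j k l)"
proof -
  define a where "a = f Gen_a"
  define b where "b = f Gen_b"
  define c where "c = commutator G a b"
  define d where "d = commutator G a c"
  have carr [simp]: "a \<in> carrier G" "b \<in> carrier G" "c \<in> carrier G" "d \<in> carrier G"
    by (simp_all add: f a_def b_def c_def d_def)
  have pow: "a [^] p = \<one>" "b [^] p = \<one>" "c [^] p = \<one>" "d [^] p = \<one>"
    and comm: "b \<otimes> c = c \<otimes> b" "a \<otimes> d = d \<otimes> a" "b \<otimes> d = d \<otimes> b"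
    using H1_relators_eval_iff[of f p] rels f
    unfolding a_def[symmetric] b_def[symmetric] c_def[symmetric] d_def[symmetric] by blast+
  define M where "M i j k l = a [^] i \<otimes> (b [^] j \<otimes> (c [^] k \<otimes> d [^] l))" for i j k l :: nat
  have M: "word_eval G f (normal_word i j k l) = M i j k l" for i j k l
    using word_eval_normal_word[of f i j k l, OF f]
    by (simp only: M_def a_def b_def c_def d_def)
  have M_closed [simp]: "M i j k l \<in> carrier G" for i j k l
    by (simp add: M_def)
  \<comment> \<open>\<open>d\<close> commutes with \<open>a\<close> and \<open>b\<close>, hence with their commutator \<open>c\<close>.\<close>
  have cd: "c \<otimes> d = d \<otimes> c"
  proof -
    have "d \<otimes> (b \<otimes> a) \<otimes> c = d \<otimes> (a \<otimes> b)"
      using mult_commutator[of a b] by (simp add: c_def m_assoc)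
    also have "\<dots> = a \<otimes> b \<otimes> d"
      using comm carr by (metis m_assoc)
    also have "\<dots> = b \<otimes> a \<otimes> c \<otimes> d"
      using mult_commutator[of a b] by (simp add: c_def m_assoc)
    also have "d \<otimes> (b \<otimes> a) \<otimes> c = b \<otimes> a \<otimes> (d \<otimes> c)"
      using comm carr by (metis m_assoc m_closed)
    finally show ?thesis
      by (simp add: m_assoc)
  qed
  have ba: "b \<otimes> a = a \<otimes> (b \<otimes> c [^] (p - 1))"
    using mult_eq_mult_inv_commutator[of a b] inv_eq_pow[of c p] pow p
    by (simp flip: c_def)
  have ca: "c \<otimes> a = a \<otimes> (c \<otimes> d [^] (p - 1))"
    using mult_eq_mult_inv_commutator[of a c] inv_eq_pow[of d p] pow p
    by (simp flip: d_def)
  have Mb: "M i j k l \<otimes> b = M i (Suc j) k l" for i j k l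
  proof -
    have "c [^] k \<otimes> b = b \<otimes> c [^] k" "d [^] l \<otimes> b = b \<otimes> d [^] l"
      using pow_push[of c c b k] pow_push[of d d b l] comm by simp_all
    then have "c [^] k \<otimes> d [^] l \<otimes> b = b \<otimes> (c [^] k \<otimes> d [^] l)"
      by (metis carr m_assoc nat_pow_closed)
    then show ?thesis
      by (simp add: M_def m_assoc)
  qed
  have Ma: "M i j k l \<otimes> a = M (Suc i) j ((p - 1) * j + k) ((p - 1) * k + l)" for i j k l
  proof -
    have bj: "b [^] j \<otimes> a = a \<otimes> (b [^] j \<otimes> c [^] ((p - 1) * j))"
    proof -
      have "b \<otimes> c [^] (p - 1) = c [^] (p - 1) \<otimes> b"
        using pow_push[of c c b "p - 1"] comm by simp
      then have "(b \<otimes> c [^] (p - 1)) [^] j = b [^] j \<otimes> c [^] ((p - 1) * j)"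
        using pow_mult_distrib[of b "c [^] (p - 1)" j] by (simp only: carr nat_pow_closed nat_pow_pow)
      then show ?thesis
        using pow_push[of b "b \<otimes> c [^] (p - 1)" a j] ba by simp
    qed
    have ck: "c [^] k \<otimes> a = a \<otimes> (c [^] k \<otimes> d [^] ((p - 1) * k))"
    proof -
      have "c \<otimes> d [^] (p - 1) = d [^] (p - 1) \<otimes> c"
        using pow_push[of d d c "p - 1"] cd by simp
      then have "(c \<otimes> d [^] (p - 1)) [^] k = c [^] k \<otimes> d [^] ((p - 1) * k)"
        using pow_mult_distrib[of c "d [^] (p - 1)" k] by (simp only: carr nat_pow_closed nat_pow_pow)
      then show ?thesis
        using pow_push[of c "c \<otimes> d [^] (p - 1)" a k] ca by simp
    qed
    have dl: "d [^] l \<otimes> a = a \<otimes> d [^] l"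
      using pow_push[of d d a l] comm by simp
    have "M i j k l \<otimes> a = a [^] i \<otimes> (b [^] j \<otimes> (c [^] k \<otimes> (d [^] l \<otimes> a)))"
      by (simp add: M_def m_assoc)
    also have "\<dots> = a [^] i \<otimes> (b [^] j \<otimes> ((c [^] k \<otimes> a) \<otimes> d [^] l))"
      by (simp add: dl m_assoc)
    also have "\<dots> = a [^] i \<otimes> ((b [^] j \<otimes> a) \<otimes> (c [^] k \<otimes> (d [^] ((p - 1) * k) \<otimes> d [^] l)))"
      by (simp add: ck m_assoc)
    also have "\<dots> = a [^] Suc i \<otimes> (b [^] j \<otimes> ((c [^] ((p - 1) * j) \<otimes> c [^] k) \<otimes>
        (d [^] ((p - 1) * k) \<otimes> d [^] l)))"
      by (simp add: bj m_assoc)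
    finally show ?thesis
      by (simp only: M_def nat_pow_mult carr)
  qed
  define S where "S = {M i j k l | i j k l. True}"
  have S_M: "M i j k l \<in> S" for i j k l
    by (auto simp: S_def)
  have S_gen: "x \<otimes> f g \<in> S" if "x \<in> S" for x g
  proof -
    obtain i j k l where "x = M i j k l" using \<open>x \<in> S\<close> by (auto simp: S_def)
    then show ?thesis
      using S_M Ma Mb by (cases g) (simp_all flip: a_def b_def)
  qed
  have S_closed: "x \<in> carrier G" if "x \<in> S" for x
    using that by (auto simp: S_def)
  have S_pow: "x \<otimes> f g [^] n \<in> S" if "x \<in> S" for x g and n :: nat
  proof (induction n)
    case (Suc n)
    then show ?case
      using S_gen[OF Suc, of g] S_closed[OF that] by (simp add: m_assoc f)
  qed (use that S_closed in simp)
  have "word_eval G f w \<in> S"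
  proof (induction w rule: rev_induct)
    case Nil
    have "\<one> = M 0 0 0 0" by (simp add: M_def)
    then show ?case by (auto simp: S_def)
  next
    case (snoc l w)
    obtain g s where l: "l = (g, s)" by (cases l)
    have "f g [^] p = \<one>"
      using pow by (cases g) (simp_all add: a_def b_def)
    then have "inv f g = f g [^] (p - 1)"
      using inv_eq_pow f p by blast
    then show ?case
      using S_gen[OF snoc] S_pow[OF snoc] by (auto simp: l word_eval_append f)
  qed
  then show ?thesis
    by (auto simp: S_def M)
qed

section \<open>The additive group\<close>

text \<open>
  Every element commutes with its multiples, so the Baker--Campbell--Hausdorff product of these is
  their sum. In particular the \<open>q\<close>-th power of every element is trivial.
\<close>

lemma H1_nearring_add_nat_pow:
  fixes n :: nat
  shows "mod4 q (k, x, y, z) [^]\<^bsub>add_monoid (H1_nearring q)\<^esub> n = mod4 q (int n * k, int n * x, int n * y, int n * z)"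
proof (induction n)
  case (Suc n)
  then show ?case
    by (simp add: H1_nearring_def mod4_bch algebra_simps del: mod4.simps)
qed (simp add: H1_nearring_def)

lemma H1_nearring_add_inv: "inv\<^bsub>add_monoid (H1_nearring q)\<^esub> (mod4 q X) = mod4 q (neg4 X)"
proof -
  interpret group "add_monoid (H1_nearring q)" by (rule group_add_H1_nearring)
  show ?thesis
    by (rule inv_equality) (auto simp: H1_nearring_def mod4_bch bch_neg4)
qed

lemma H1_nearring_add_mult: "mod4 q X \<otimes>\<^bsub>add_monoid (H1_nearring q)\<^esub> mod4 q Y = mod4 q (bch X Y)"
  by (simp add: H1_nearring_def mod4_bch)

lemma H1_nearring_add_commutator:
  "commutator (add_monoid (H1_nearring q)) (mod4 q X) (mod4 q Y) =
    mod4 q (bch (neg4 X) (bch (neg4 Y) (bch X Y)))"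
  unfolding commutator_def H1_nearring_add_inv H1_nearring_add_mult ..

text \<open>
  The generators \<open>a\<close> and \<open>b\<close> go to \<open>e\<^sub>0\<close> and \<open>e\<^sub>1\<close>. The value of a normal word determines its exponents
  modulo \<open>p\<close> and can be prescribed arbitrarily, because its coordinates are triangular in the exponents
  with diagonal coefficients \<open>1, 1, 2, 12\<close>, which are invertible for \<open>p > 3\<close>. Injectivity then follows
  as every element of \<open>H1 p\<close> is the class of a normal word.
\<close>

lemma add_H1_nearring_iso_H1:
  assumes "prime p" and "p > 3"
  shows "add_monoid (H1_nearring (int p)) \<cong> H1 p"
proof -
  define q where "q = int p"
  have q: "prime q" "q > 3" using assms by (simp_all add: q_def)
  let ?G = "add_monoid (H1_nearring q)"
  interpret N: group ?G by (rule group_add_H1_nearring)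
  interpret P: group "presented_group (H1_relators p)" by (rule group_presented_group)
  define f where "f = case_H1_gen (mod4 q (1, 0, 0, 0)) (mod4 q (0, 1, 0, 0))"
  have fa: "f Gen_a = mod4 q (1, 0, 0, 0)" and fb: "f Gen_b = mod4 q (0, 1, 0, 0)"
    by (simp_all add: f_def)
  have f: "f x \<in> carrier ?G" for x
    by (cases x) (simp_all add: fa fb H1_nearring_def del: mod4.simps)
  have c: "commutator ?G (f Gen_a) (f Gen_b) = mod4 q (0, 0, 2, - 6)"
    unfolding fa fb H1_nearring_add_commutator by (simp del: mod4.simps)
  have d: "commutator ?G (f Gen_a) (mod4 q (0, 0, 2, - 6)) = mod4 q (0, 0, 0, 12)"
    unfolding fa H1_nearring_add_commutator by (simp del: mod4.simps)
  have one: "\<one>\<^bsub>?G\<^esub> = mod4 q (0, 0, 0, 0)"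
    by (simp add: H1_nearring_def)
  have rels: "word_eval ?G f r = \<one>\<^bsub>?G\<^esub>" if "r \<in> H1_relators p" for r
  proof -
    have "\<forall>r \<in> H1_relators p. word_eval ?G f r = \<one>\<^bsub>?G\<^esub>"
      unfolding N.H1_relators_eval_iff[of f p, OF f] c d
      unfolding fa fb H1_nearring_add_nat_pow H1_nearring_add_mult one mod4_eq_iff
      by (simp add: q_def)
    then show ?thesis using that by blast
  qed
  obtain h where h: "group_hom (presented_group (H1_relators p)) ?G h"
    and h_class: "\<And>w. h (word_rel (H1_relators p) `` {w}) = word_eval ?G f w"
    using N.presented_group_hom[of f "H1_relators p", OF f rels] by blast
  interpret h: group_hom "presented_group (H1_relators p)" ?G h by (rule h)
  have eval: "word_eval ?G f (normal_word i j k l) =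
      mod4 q (int i, int j, int i * int j + 2 * int k,
        int i * int i * int j + 6 * (int i * int k - int k + 2 * int l))" for i j k l
    unfolding N.word_eval_normal_word[of f, OF f] c d
    unfolding fa fb H1_nearring_add_nat_pow H1_nearring_add_mult
    by (simp add: algebra_simps del: mod4.simps)
  have dvd2: "q dvd x" if "q dvd 2 * x" for x
    using that q by (auto simp: prime_dvd_mult_iff dest: zdvd_imp_le)
  have dvd3: "q dvd x" if "q dvd 3 * x" for x
    using that q by (auto simp: prime_dvd_mult_iff dest: zdvd_imp_le)
  have inj: "inj_on h (carrier (presented_group (H1_relators p)))"
    unfolding h.inj_on_one_iff
  proof (intro allI impI)
    let ?H = "presented_group (H1_relators p)"
    let ?g = "\<lambda>x. word_rel (H1_relators p) `` {gen_word x}"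
    fix U assume U: "U \<in> carrier ?H" and hU: "h U = \<one>\<^bsub>?G\<^esub>"
    obtain w where w: "U = word_rel (H1_relators p) `` {w}"
      using U by (rule presented_group_cases)
    have H_rels: "word_eval ?H ?g r = \<one>\<^bsub>?H\<^esub>" if "r \<in> H1_relators p" for r
      using word_eq.relator[OF that, of "[]" "[]"]
      by (simp add: class_eq_word_eval[symmetric] presented_group_one class_eq_iff)
    have g: "?g x \<in> carrier ?H" for x by simp
    obtain i j k l where nf: "word_eval ?H ?g w = word_eval ?H ?g (normal_word i j k l)"
      using P.word_eval_normal_form[of ?g p w, OF g _ H_rels] assms by auto
    then have U': "U = word_rel (H1_relators p) `` {normal_word i j k l}"
      by (simp add: w class_eq_word_eval[symmetric])
    have "mod4 q (int i, int j, int i * int j + 2 * int k,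
        int i * int i * int j + 6 * (int i * int k - int k + 2 * int l)) = mod4 q (0, 0, 0, 0)"
      using hU by (simp only: U' h_class eval one)
    then have *: "q dvd int i" "q dvd int j" "q dvd int i * int j + 2 * int k"
      "q dvd int i * int i * int j + 6 * (int i * int k - int k + 2 * int l)"
      unfolding mod4_eq_iff by simp_all
    from *(2,3) have "q dvd 2 * int k"
      by (simp add: dvd_add_right_iff)
    then have k: "q dvd int k" by (rule dvd2)
    have "q dvd int i * int i * int j + 6 * (int i * int k - int k)"
      using *(1,2) k by auto
    then have "q dvd int i * int i * int j + 6 * (int i * int k - int k + 2 * int l) -
        (int i * int i * int j + 6 * (int i * int k - int k))"
      by (rule dvd_diff[OF *(4)])
    moreover have "int i * int i * int j + 6 * (int i * int k - int k + 2 * int l) -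
        (int i * int i * int j + 6 * (int i * int k - int k)) = 3 * (2 * (2 * int l))"
      by simp
    ultimately have "q dvd 3 * (2 * (2 * int l))"
      by (simp only:)
    then have l: "q dvd int l" using dvd2 dvd3 by blast
    have dvd: "p dvd i" "p dvd j" "p dvd k" "p dvd l"
      using *(1,2) k l by (simp_all add: q_def)
    then have "word_eval ?H ?g (normal_word i j k l) = \<one>\<^bsub>?H\<^esub>"
      using P.word_eval_normal_word_dvd[of ?g p i j k l, OF g H_rels] by simp
    then show "U = \<one>\<^bsub>?H\<^esub>"
      by (simp only: U' class_eq_word_eval[symmetric])
  qed
  have surj: "carrier ?G \<subseteq> h ` carrier (presented_group (H1_relators p))"
  proof
    fix X assume "X \<in> carrier ?G"
    then obtain m u v w where X: "X = mod4 q (m, u, v, w)"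
      by (auto simp: H1_nearring_def)
    have "\<exists>r. [c * r = 1] (mod q)" if "\<not> q dvd c" for c
      using that prime_imp_coprime[OF q(1)] coprime_commute cong_solve_coprime_int by blast
    moreover have "\<not> q dvd 2" "\<not> q dvd 3"
      using q zdvd_imp_le[of q 2] zdvd_imp_le[of q 3] by auto
    moreover from this have "\<not> q dvd 12"
      using dvd2[of 6] dvd2[of 3] by auto
    ultimately obtain r s where r: "[2 * r = 1] (mod q)" and s: "[12 * s = 1] (mod q)"
      by meson
    \<comment> \<open>The exponents \<open>m, u, K, L\<close> are found by solving the triangular system from the top.\<close>
    define K where "K = r * (v - m * u)"
    define L where "L = s * (w - m * m * u - 6 * (m * K - K))"
    define n where "n x = nat (x mod q)" for x
    have n: "[int (n x) = x] (mod q)" for x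
      using q by (simp add: n_def cong_def)
    have "word_eval ?G f (normal_word (n m) (n u) (n K) (n L)) =
        mod4 q (m, u, m * u + 2 * K, m * m * u + 6 * (m * K - K + 2 * L))"
      unfolding eval by (intro mod4_cong cong_add cong_mult cong_diff n cong_refl)
    also have "\<dots> = mod4 q (m, u, m * u + 1 * (v - m * u),
        m * m * u + 6 * (m * K - K) + 1 * (w - m * m * u - 6 * (m * K - K)))"
    proof (intro mod4_cong cong_refl)
      have "[m * u + (2 * r) * (v - m * u) = m * u + 1 * (v - m * u)] (mod q)"
        by (intro cong_add cong_mult cong_refl r)
      then show "[m * u + 2 * K = m * u + 1 * (v - m * u)] (mod q)"
        by (simp add: K_def mult.assoc)
      have "[m * m * u + 6 * (m * K - K) + (12 * s) * (w - m * m * u - 6 * (m * K - K)) =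
          m * m * u + 6 * (m * K - K) + 1 * (w - m * m * u - 6 * (m * K - K))] (mod q)"
        by (intro cong_add cong_mult cong_refl s)
      moreover have "m * m * u + 6 * (m * K - K + 2 * L) =
          m * m * u + 6 * (m * K - K) + (12 * s) * (w - m * m * u - 6 * (m * K - K))"
        by (simp add: L_def)
      ultimately show "[m * m * u + 6 * (m * K - K + 2 * L) =
          m * m * u + 6 * (m * K - K) + 1 * (w - m * m * u - 6 * (m * K - K))] (mod q)"
        by (simp only:)
    qed
    also have "\<dots> = X" by (simp add: X)
    finally have "X = h (word_rel (H1_relators p) `` {normal_word (n m) (n u) (n K) (n L)})"
      by (simp add: h_class)
    then show "X \<in> h ` carrier (presented_group (H1_relators p))" by blast
  qed
  have "h \<in> iso (presented_group (H1_relators p)) ?G"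
    using h.homh inj surj h.hom_closed by (auto simp: iso_def bij_betw_def)
  then have "presented_group (H1_relators p) \<cong> ?G" by (rule is_isoI)
  then show ?thesis
    unfolding H1_def q_def[symmetric] by (rule P.iso_sym)
qed

theorem theorem5:
  fixes p :: nat
  assumes "prime p" and "p > 3"
  shows "\<exists>R :: nat ring. local_nearring R \<and> add_monoid R \<cong> H1 p"
proof -
  let ?R = "image_ring (to_nat :: int4 \<Rightarrow> nat) (H1_nearring (int p))"
  have "local_nearring (H1_nearring (int p))" using assms by (simp add: local_nearring_H1_nearring)
  then have "local_nearring ?R" "add_monoid ?R \<cong> add_monoid (H1_nearring (int p))"
    by (rule local_nearring_image_ring; simp)+
  then show ?thesis
    using iso_trans[OF _ add_H1_nearring_iso_H1[OF assms]] by blast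
qed

end
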